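(* Let $P \subseteq \mathbb{R}^n$ be the LP relaxation of a corner polyhedron, so that $P$ is a simple pointed cone: it has a vertex $v$ and can be expressed as $v$ plus the conic combinations of its $\dim(P)$ extreme rays. Write $P = \{x \in \mathcal{L} : Ax \le b\}$, where $\mathcal{L}$ is the affine hull of $P$ and $A$ (with rows $a^i$) contains no redundant inequalities. Let $L \in \mathbb{R}^{(n-\dim(\mathcal{L}))\times n}$ be a full row rank matrix such that $\mathcal{L} = \{x \in \mathbb{R}^n : Lx = \xi\}$ for some $\xi \in \mathbb{R}^{n-\dim(\mathcal{L})}$. For each $i$ let $t^i$ be the vector with $\|t^i\|=1$, lying in the linear direction space $\{x : Lx = 0\}$ of $\mathcal{L}$, and satisfying $\{x \in \mathcal{L} : {a^i}^T x \le b_i\} = \{x \in \mathcal{L} : {t^i}^T x \le h_i\}$ for some $h_i$; let $T$ be the matrix whose $i$th row is $t^i$. Define \[ q := -\begin{bmatrix} T \\ L \end{bmatrix}^{-1} \begin{bmatrix} \mathbf{1} \\ 0 \end{bmatrix}, \] where $\mathbf{1}$ is the all-ones vector. Let $C$ be the recession cone of $P$, and let $\alpha^T x \ge \beta$ be a cutting plane, i.e. an inequality valid for $P \cap \mathbb{Z}^n$. Assume that there is no ray $r \in C$ of $P$ such that $\alpha^T r < \beta$, that $\alpha^T v \le \beta$, and that $\alpha^T q > \beta$. Then \[ \operatorname{depth}_P(\alpha,\beta) = \frac{\beta - \alpha^T v}{\alpha^T q}. \]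
   Context: $\|\cdot\|$ is the Euclidean norm on $\mathbb{R}^n$, and $B(x,r) := \{y \in \mathbb{R}^n : \|y-x\| \le r\}$ for $r \in \mathbb{R}_+$. For $P \subseteq \mathbb{R}^n$ and $x \in P$, $\operatorname{depth}_P(x) := \sup\{ r \in \mathbb{R}_+ : B(x,r) \cap \operatorname{aff}(P) \subseteq P\}$, where $\operatorname{aff}(P)$ is the affine hull of $P$. For $S \subseteq P$, $\operatorname{depth}_P(S) := \sup\{\operatorname{depth}_P(x) : x \in P \setminus S\}$. For an inequality $\alpha^T x \ge \beta$ valid for $P \cap \mathbb{Z}^n$, $\operatorname{depth}_P(\alpha,\beta) := \operatorname{depth}_P(\{x \in P : \alpha^T x \ge \beta\})$. An example of a corner polyhedron is $\{(x,s) \in \mathbb{Z}^{k} \times \mathbb{Z}^{l}_+ : x = f + Rs\}$ with $f$ a vector and $R$ a $k \times l$ matrix; its LP relaxation is obtained by dropping the integrality requirements, and is an affine image of an orthant. *)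

theory Defs
  imports "HOL-Analysis.Analysis"
begin

definition integer_points :: "(real^'n) set" where
  "integer_points = {x. \<forall>i. x $ i \<in> \<int>}"

text \<open>
  Depths are suprema of nonnegative reals, hence values in \<^typ>\<open>ennreal\<close>: an unbounded
  set has supremum \<open>\<infinity>\<close>, and the empty set has supremum \<open>0\<close>.
\<close>

definition point_depth :: "'a::euclidean_space set \<Rightarrow> 'a \<Rightarrow> ennreal" where
  "point_depth P x = (SUP r \<in> {r. 0 \<le> r \<and> cball x r \<inter> affine hull P \<subseteq> P}. ennreal r)"

definition set_depth :: "'a::euclidean_space set \<Rightarrow> 'a set \<Rightarrow> ennreal" where
  "set_depth P S = (SUP x \<in> P - S. point_depth P x)"

definition valid_inequality :: "'a::real_inner \<Rightarrow> real \<Rightarrow> 'a set \<Rightarrow> bool" where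
  "valid_inequality \<alpha> \<beta> S \<longleftrightarrow> (\<forall>x\<in>S. \<alpha> \<bullet> x \<ge> \<beta>)"

definition cut_depth :: "'a::euclidean_space set \<Rightarrow> 'a \<Rightarrow> real \<Rightarrow> ennreal" where
  "cut_depth P \<alpha> \<beta> = set_depth P {x \<in> P. \<alpha> \<bullet> x \<ge> \<beta>}"

definition recession_cone :: "'a::real_vector set \<Rightarrow> 'a set" where
  "recession_cone P = {r. \<forall>x\<in>P. \<forall>c\<ge>0. x + c *\<^sub>R r \<in> P}"

definition extreme_ray :: "'a::real_vector set \<Rightarrow> 'a \<Rightarrow> 'a \<Rightarrow> bool" where
  "extreme_ray P v r \<longleftrightarrow> r \<noteq> 0 \<and> {v + c *\<^sub>R r | c. 0 \<le> c} face_of P"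

text \<open>
  \<open>R\<close> contains one direction vector per extreme ray. The LP relaxation
  \<open>{(x, s). x = f + R s \<and> 0 \<le> s}\<close> of a corner polyhedron is of this form, with vertex \<open>(f, 0)\<close>
  and the directions \<open>(R\<^sub>j, e\<^sub>j)\<close>, where \<open>R\<^sub>j\<close> is a column of the matrix \<open>R\<close> of that system.
\<close>

definition simple_pointed_cone :: "'a::euclidean_space set \<Rightarrow> 'a \<Rightarrow> bool" where
  "simple_pointed_cone P v \<longleftrightarrow>
     v extreme_point_of P \<and>
     (\<exists>R. finite R \<and> int (card R) = aff_dim P \<and> (\<forall>r\<in>R. extreme_ray P v r) \<and>
          P = {v + (\<Sum>r\<in>R. c r *\<^sub>R r) | c. \<forall>r\<in>R. 0 \<le> c r})"

text \<open>
  A type-indexed matrix cannot have zero rows, but either block of \<open>[T; L]\<close> may be empty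
  (\<open>L\<close> when the cone is full-dimensional, \<open>T\<close> when it is a single point). The rows of the stacked
  matrix are therefore indexed by one finite type \<open>'r\<close>: the rows in \<open>I\<close> form the upper block, those
  in \<open>- I\<close> the lower block. Rows of \<open>T\<close> outside \<open>I\<close> and of \<open>L\<close> inside \<open>I\<close> are meaningless. No
  relation between the numbers of elements of \<open>'r\<close> and \<open>'n\<close> is presupposed.
\<close>

definition stack :: "'r set \<Rightarrow> 'a^'r \<Rightarrow> 'a^'r \<Rightarrow> 'a^'r" where
  "stack I T L = (\<chi> i. if i \<in> I then T $ i else L $ i)"

end

theory Submission
  imports Defs
begin

text \<open>
  Translate the vertex to the origin. Irredundancy forces all inequalities to be tight there and
  pairs the facets of the simplicial cone \<open>C\<close> with its rays, so the stacked matrix is square and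
  injective, and \<open>q\<close> is the direction in \<open>C\<close> with \<open>T q = - 1\<close>. A ball of radius \<open>\<rho>\<close> around
  \<open>v + y\<close> stays in \<open>P\<close> (within the affine hull) iff \<open>T y \<le> - \<rho>\<close>, i.e. iff \<open>y - \<rho> q \<in> C\<close>. As \<open>\<alpha>\<close> is
  nonnegative on \<open>C\<close>, some point cut off has depth \<open>\<ge> \<rho>\<close> iff \<open>v + \<rho> q\<close> itself is cut off, that is, iff
  \<open>\<rho> (\<alpha> \<bullet> q) < \<beta> - \<alpha> \<bullet> v\<close>.
\<close>

section \<open>Cones generated by a finite set, and their coefficients\<close>

definition simplicial_cone :: "'a::real_vector set \<Rightarrow> 'a set" where
  "simplicial_cone R = {\<Sum>r\<in>R. c r *\<^sub>R r |c. \<forall>r\<in>R. 0 \<le> c r}"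

lemma span_coefficients:
  fixes R :: "'a::real_vector set"
  assumes "finite R" "y \<in> span R"
  obtains c where "y = (\<Sum>r\<in>R. c r *\<^sub>R r)"
  using assms by (auto simp: span_finite)

text \<open>Independence makes the coefficients of a point unique, so membership in the cone can be
  read off any representation.\<close>

lemma cone_combination_iff:
  fixes R :: "'a::real_vector set"
  assumes "finite R" "independent R"
  shows "(\<Sum>r\<in>R. c r *\<^sub>R r) \<in> simplicial_cone R \<longleftrightarrow> (\<forall>r\<in>R. 0 \<le> c r)"
proof
  assume "(\<Sum>r\<in>R. c r *\<^sub>R r) \<in> simplicial_cone R"
  then obtain d where d: "(\<Sum>r\<in>R. c r *\<^sub>R r) = (\<Sum>r\<in>R. d r *\<^sub>R r)" "\<forall>r\<in>R. 0 \<le> d r"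
    by (auto simp: simplicial_cone_def)
  then have "(\<Sum>r\<in>R. (c r - d r) *\<^sub>R r) = 0"
    by (simp add: algebra_simps sum_subtractf)
  then have "c r - d r = 0" if "r \<in> R" for r
    using independentD[OF assms(2,1), of "\<lambda>r. c r - d r" r] that by auto
  then show "\<forall>r\<in>R. 0 \<le> c r"
    using d(2) by auto
qed (auto simp: simplicial_cone_def)

lemma subset_simplicial_cone:
  assumes "finite R"
  shows "R \<subseteq> simplicial_cone R"
proof
  fix r assume "r \<in> R"
  then have "r = (\<Sum>s\<in>R. (if s = r then 1 else 0) *\<^sub>R s)"
    using assms by (simp add: if_distrib[of "\<lambda>a. a *\<^sub>R _"] cong: if_cong)
  then show "r \<in> simplicial_cone R"
    unfolding simplicial_cone_def by (intro CollectI exI[of _ "\<lambda>s. if s = r then 1 else 0"]) auto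
qed

section \<open>Irredundant inequality systems of simplicial cones\<close>

lemma small_step_feasible:
  fixes s t h :: "'i \<Rightarrow> real"
  assumes "finite I" and "\<And>i. i \<in> I \<Longrightarrow> s i < h i \<or> s i = h i \<and> t i \<le> 0"
  shows "\<exists>e>0. \<forall>i\<in>I. s i + e * t i \<le> h i"
proof -
  have "eventually (\<lambda>e. s i + e * t i \<le> h i) (at_right 0)" if "i \<in> I" for i
    using assms(2)[OF that]
  proof
    assume "s i < h i"
    have "((\<lambda>e. s i + e * t i) \<longlongrightarrow> s i + 0 * t i) (at_right 0)"
      by (intro tendsto_intros)
    then have "eventually (\<lambda>e. s i + e * t i < h i) (at_right 0)"
      using \<open>s i < h i\<close> by (intro order_tendstoD) auto
    then show ?thesis
      by (rule eventually_mono) auto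
  next
    assume "s i = h i \<and> t i \<le> 0"
    then show ?thesis
      using eventually_at_right_less[of "0::real"]
      by (auto elim!: eventually_mono simp: mult_le_0_iff)
  qed
  then have "eventually (\<lambda>e. \<forall>i\<in>I. s i + e * t i \<le> h i) (at_right 0)"
    using assms(1) by (intro eventually_ball_finite) auto
  then have "eventually (\<lambda>e. e > 0 \<and> (\<forall>i\<in>I. s i + e * t i \<le> h i)) (at_right 0)"
    using eventually_at_right_less[of "0::real"] by eventually_elim auto
  from eventually_happens'[OF trivial_limit_at_right_real this] show ?thesis
    by simp
qed

text \<open>A constraint with positive right-hand side is slack near the origin, and a cone is
  determined by its points near the origin, so such a constraint could be dropped.\<close>

lemma irredundant_cone_constraints_tight:
  fixes T :: "'i \<Rightarrow> 'a::real_inner"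
  assumes I: "finite I" and C: "cone C" "0 \<in> C"
    and D: "subspace D"
    and C_eq: "C = {y\<in>D. \<forall>i\<in>I. T i \<bullet> y \<le> h i}"
    and irr: "\<And>i. i \<in> I \<Longrightarrow> {y\<in>D. \<forall>j\<in>I - {i}. T j \<bullet> y \<le> h j} \<noteq> C"
    and i: "i \<in> I"
  shows "h i = 0"
proof (rule ccontr)
  assume "h i \<noteq> 0"
  have h: "h j \<ge> 0" if "j \<in> I" for j
    using C(2) that unfolding C_eq by auto
  have "y \<in> C" if y: "y \<in> D" "\<forall>j\<in>I - {i}. T j \<bullet> y \<le> h j" for y
  proof -
    \<comment> \<open>Small multiples of \<open>y\<close> satisfy the slack constraint \<open>i\<close> as well, and \<open>C\<close> is a cone.\<close>
    have "0 < h j \<or> 0 = h j \<and> T j \<bullet> y \<le> 0" if "j \<in> I" for j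
      using y(2)[rule_format, of j] h[OF that] that \<open>h i \<noteq> 0\<close> by (cases "j = i") auto
    then obtain e where e: "e > 0" "\<forall>j\<in>I. 0 + e * (T j \<bullet> y) \<le> h j"
      using small_step_feasible[OF I, of "\<lambda>_. 0" h "\<lambda>j. T j \<bullet> y"] by blast
    have "e *\<^sub>R y \<in> C"
      unfolding C_eq using e y D by (auto simp: subspace_scale)
    then show "y \<in> C"
      using C(1)[unfolded cone_def, rule_format, of "e *\<^sub>R y" "1 / e"] e(1) by simp
  qed
  moreover have "C \<subseteq> {y\<in>D. \<forall>j\<in>I - {i}. T j \<bullet> y \<le> h j}"
    unfolding C_eq by auto
  ultimately show False
    using irr[OF i] by blast
qed

text \<open>The sum \<open>w\<close> of the other generators lies on the face opposite to
  \<open>r\<close>, and any step from \<open>w\<close> along \<open>- r\<close> leaves the cone.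
  Some constraint must block arbitrarily small steps, so it is tight at \<open>w\<close> and
  negative on \<open>r\<close>. It is nonpositive on every generator, so tightness at the sum
  \<open>w\<close> makes it vanish on each summand.\<close>

lemma simplicial_cone_facet_opposite_ray:
  fixes T :: "'i \<Rightarrow> 'a::real_inner"
  assumes R: "finite R" "independent R" and I: "finite I"
    and C_eq: "simplicial_cone R = {y \<in> span R. \<forall>i\<in>I. T i \<bullet> y \<le> 0}"
    and r: "r \<in> R"
  shows "\<exists>i\<in>I. T i \<bullet> r < 0 \<and> (\<forall>r'\<in>R - {r}. T i \<bullet> r' = 0)"
proof -
  define w where "w = (\<Sum>r'\<in>R - {r}. r')"
  have wC: "w - e *\<^sub>R r \<in> simplicial_cone R \<longleftrightarrow> e \<le> 0" for e
  proof -
    have "w - e *\<^sub>R r = (\<Sum>r'\<in>R. (if r' = r then - e else 1) *\<^sub>R r')"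
      unfolding w_def using R(1) r by (simp add: sum.remove[of R r] cong: sum.cong_simp)
    then show ?thesis
      using cone_combination_iff[OF R, of "\<lambda>r'. if r' = r then - e else 1"] r by auto
  qed
  have ray: "T i \<bullet> r' \<le> 0" if "i \<in> I" "r' \<in> R" for i r'
  proof -
    have "r' \<in> simplicial_cone R"
      using subset_simplicial_cone[OF R(1)] that by blast
    then show ?thesis
      using that C_eq by auto
  qed
  \<comment> \<open>The negated disjunction is the hypothesis of \<open>small_step_feasible\<close>
    for the direction \<open>- r\<close>. If all constraints met it, a short step would stay in the
    cone, against \<open>wC\<close>.\<close>
  have "\<exists>i\<in>I. \<not> (T i \<bullet> w < 0 \<or> T i \<bullet> w = 0 \<and> - (T i \<bullet> r) \<le> 0)"
  proof (rule ccontr)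
    assume "\<not> ?thesis"
    then obtain e where e: "e > 0" "\<forall>i\<in>I. T i \<bullet> w + e * - (T i \<bullet> r) \<le> 0"
      using small_step_feasible[OF I, of "\<lambda>i. T i \<bullet> w" "\<lambda>_. 0" "\<lambda>i. - (T i \<bullet> r)"] by blast
    have "w - e *\<^sub>R r \<in> span R"
      unfolding w_def using r by (intro span_diff span_sum span_scale span_base) auto
    then have "w - e *\<^sub>R r \<in> simplicial_cone R"
      unfolding C_eq using e by (auto simp: inner_diff_right)
    then show False
      using wC e(1) by simp
  qed
  then obtain i where i: "i \<in> I" "T i \<bullet> w \<ge> 0" "T i \<bullet> w \<noteq> 0 \<or> T i \<bullet> r < 0"
    by (auto simp: not_less not_le)
  have w_sum: "T i \<bullet> w = (\<Sum>r'\<in>R - {r}. T i \<bullet> r')"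
    unfolding w_def by (simp add: inner_sum_right)
  then have "T i \<bullet> w \<le> 0"
    using ray[OF i(1)] by (auto intro!: sum_nonpos)
  then have w0: "T i \<bullet> w = 0"
    using i(2) by simp
  have "\<forall>r'\<in>R - {r}. T i \<bullet> r' = 0"
    using sum_nonneg_eq_0_iff[of "R - {r}" "\<lambda>r'. - (T i \<bullet> r')"] ray[OF i(1)] R(1) w0 w_sum
    by (auto simp: sum_negf)
  then show ?thesis
    using i w0 by auto
qed

text \<open>Sending each generator to a constraint opposite to it gives a bijection \<open>f\<close>
  from \<open>R\<close> to \<open>I\<close>. It is injective because the constraint
  \<open>f r\<close> is negative on \<open>r\<close> and zero on all other generators. It is
  surjective because the constraints in its image already cut out the cone, so that any further one
  would be redundant.\<close>

lemma simplicial_cone_facets: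
  fixes T :: "'i \<Rightarrow> 'a::real_inner"
  assumes R: "finite R" "independent R" and I: "finite I"
    and C_eq: "simplicial_cone R = {y \<in> span R. \<forall>i\<in>I. T i \<bullet> y \<le> 0}"
    and irr: "\<And>i. i \<in> I \<Longrightarrow> {y \<in> span R. \<forall>j\<in>I - {i}. T j \<bullet> y \<le> 0} \<noteq> simplicial_cone R"
  shows "card I = card R"
    and "\<And>y. \<lbrakk>y \<in> span R; \<And>i. i \<in> I \<Longrightarrow> T i \<bullet> y = 0\<rbrakk> \<Longrightarrow> y = 0"
proof -
  obtain f where f: "\<And>r. r \<in> R \<Longrightarrow> f r \<in> I" "\<And>r. r \<in> R \<Longrightarrow> T (f r) \<bullet> r < 0"
      "\<And>r r'. r \<in> R \<Longrightarrow> r' \<in> R - {r} \<Longrightarrow> T (f r) \<bullet> r' = 0"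
    using simplicial_cone_facet_opposite_ray[OF R I C_eq] by metis
  \<comment> \<open>Up to a negative factor, the constraint \<open>f r\<close> is the coordinate
    function of \<open>r\<close>.\<close>
  have coeff: "T (f r) \<bullet> (\<Sum>r'\<in>R. c r' *\<^sub>R r') = c r * (T (f r) \<bullet> r)" if "r \<in> R" for c r
    using R(1) f(3)[OF that] by (simp add: inner_add_right inner_sum_right sum.remove[OF _ that])
  have inj: "inj_on f R"
    by (rule inj_onI) (metis Diff_iff f(2) f(3) less_irrefl singletonD)
  have "I \<subseteq> f ` R"
  proof
    fix i assume i: "i \<in> I"
    show "i \<in> f ` R"
    proof (rule ccontr)
      assume "i \<notin> f ` R"
      then have fi: "f r \<in> I - {i}" if "r \<in> R" for r
        using f(1) that by auto
      have "y \<in> simplicial_cone R" if y: "y \<in> span R" "\<forall>j\<in>I - {i}. T j \<bullet> y \<le> 0" for y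
      proof -
        obtain c where c: "y = (\<Sum>r\<in>R. c r *\<^sub>R r)"
          using span_coefficients[OF R(1) y(1)] .
        have "0 \<le> c r" if "r \<in> R" for r
        proof -
          have "c r * (T (f r) \<bullet> r) \<le> 0"
            using y(2) fi[OF that] coeff[OF that] c by metis
          then show ?thesis
            using f(2)[OF that] by (simp add: mult_le_0_iff)
        qed
        then show ?thesis
          using c by (auto simp: simplicial_cone_def)
      qed
      moreover have "simplicial_cone R \<subseteq> {y \<in> span R. \<forall>j\<in>I - {i}. T j \<bullet> y \<le> 0}"
        unfolding C_eq by auto
      ultimately show False
        using irr[OF i] by blast
    qed
  qed
  then have "I = f ` R"
    using f(1) by auto
  then show "card I = card R"
    using inj by (simp add: card_image)
  fix y assume y: "y \<in> span R" "\<And>i. i \<in> I \<Longrightarrow> T i \<bullet> y = 0"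
  obtain c where c: "y = (\<Sum>r\<in>R. c r *\<^sub>R r)"
    using span_coefficients[OF R(1) y(1)] .
  have "c r = 0" if "r \<in> R" for r
    using y(2)[OF f(1)[OF that]] coeff[OF that, of c] f(2)[OF that] c by auto
  then show "y = 0"
    using c by simp
qed

section \<open>Inverting the stacked matrix\<close>

lemma matrix_vector_mul_matrix_inv:
  fixes S :: "real^'n^'m"
  assumes "CARD('m) = CARD('n)" "\<And>y. S *v y = 0 \<Longrightarrow> y = 0"
  shows "S *v (matrix_inv S *v e) = e"
proof -
  have inj: "inj ((*v) S)"
    using assms(2) by (simp add: linear_injective_0)
  then obtain B where B: "B ** S = mat 1"
    using matrix_left_invertible_injective by blast
  obtain g where g: "\<And>x. S *v g x = x"
    using linear_injective_isomorphism[OF matrix_vector_mul_linear inj] assms(1) by auto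
  have "S *v (B *v x) = x" for x
    by (metis B g matrix_vector_mul_assoc matrix_vector_mul_lid)
  then have "S ** B = mat 1"
    by (simp add: matrix_eq flip: matrix_vector_mul_assoc)
  \<comment> \<open>\<open>matrix_inv\<close> is a choice among two-sided inverses, so its
    properties follow only once one such inverse, here \<open>B\<close>, is exhibited.\<close>
  then have "S ** matrix_inv S = mat 1"
    unfolding matrix_inv_def using B someI[of "\<lambda>X. S ** X = mat 1 \<and> X ** S = mat 1" B]
    by blast
  then show ?thesis
    by (simp add: matrix_vector_mul_assoc)
qed

text \<open>Translating \<open>v\<close> to the origin turns the affine hull into
  \<open>span R\<close>. Its dimension is \<open>aff_dim P\<close>, which equals
  \<open>card R\<close>, and a spanning set of that size is independent.\<close>

lemma simple_pointed_cone_rays: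
  fixes P :: "'a::euclidean_space set"
  assumes "simple_pointed_cone P v"
  obtains R where "finite R" "independent R" "int (card R) = aff_dim P"
    "affine hull P = {v + y |y. y \<in> span R}"
    "P = {v + y |y. y \<in> simplicial_cone R}"
proof -
  obtain R where R: "finite R" "int (card R) = aff_dim P"
    and P: "P = {v + (\<Sum>r\<in>R. c r *\<^sub>R r) | c. \<forall>r\<in>R. 0 \<le> c r}"
    using assms unfolding simple_pointed_cone_def by auto
  define C where C_eq: "C = simplicial_cone R"
  note C_def = C_eq[unfolded simplicial_cone_def]
  have P': "P = {v + y |y. y \<in> C}"
    unfolding P C_def by blast
  have C: "(+) (- v) ` P = C"
    unfolding P' by force
  have "0 \<in> C"
    unfolding C_def by (auto intro!: exI[of _ "\<lambda>_. 0"])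
  then have v: "v \<in> affine hull P"
    unfolding P' by (auto intro!: hull_inc)
  have "R \<subseteq> C"
    unfolding C_eq by (rule subset_simplicial_cone[OF R(1)])
  moreover have "C \<subseteq> span R"
    unfolding C_def by (auto intro: span_sum span_scale span_base)
  ultimately have span: "span C = span R"
    by (simp add: span_eq span_superset subset_trans)
  have "aff_dim P = int (dim C)"
    using aff_dim_eq_dim[OF v] C by simp
  then have "dim C = card R"
    using R(2) by simp
  then have "dim (span R) = card R"
    using span by (metis dim_span)
  then have "independent R"
    using R(1) by (intro card_le_dim_spanning[of R "span R"]) (auto simp: span_superset)
  moreover have "affine hull P = {v + y |y. y \<in> span R}"
    using affine_hull_span_gen[OF v] C span by auto
  ultimately show thesis
    using that R P' unfolding C_eq by blast
qed

section \<open>Depths as suprema of radii\<close>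

lemma enn2ereal_SUP_mult_less:
  fixes k w :: real
  assumes k: "0 \<le> k" and w: "0 \<le> w"
  shows "enn2ereal (SUP \<rho> \<in> {\<rho>. 0 \<le> \<rho> \<and> \<rho> * w < k}. ennreal \<rho>) = ereal k / ereal w"
    (is "enn2ereal ?S = _")
proof (cases "w = 0")
  case w0: True
  show ?thesis
  \<comment> \<open>With \<open>w = 0\<close>, strictness leaves no radius when \<open>k = 0\<close>
    and every radius when \<open>k > 0\<close>. The suprema \<open>0\<close> and infinity agree with
    the \<open>ereal\<close> quotients \<open>0 / 0 = 0\<close> and
    \<open>k / 0 = \<infinity>\<close>.\<close>
  proof (cases "k = 0")
    case True
    then show ?thesis using w0 by (simp add: bot_ennreal zero_ennreal.rep_eq)
  next
    case False
    have "?S = top"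
    proof (rule ennreal_SUP_eq_top)
      fix n :: nat
      show "\<exists>i\<in>{\<rho>. 0 \<le> \<rho> \<and> \<rho> * w < k}. of_nat n \<le> ennreal i"
        using w0 k False by (intro bexI[of _ "real n"]) (auto simp: ennreal_of_nat_eq_real_of_nat)
    qed
    then show ?thesis
      using w0 k False by (simp add: enn2ereal_top)
  qed
next
  case False
  then have w: "w > 0" using w by simp
  have "?S = ennreal (k / w)"
  proof (rule antisym)
    show "?S \<le> ennreal (k / w)"
      using w by (intro SUP_least ennreal_leI) (auto simp: field_simps)
    show "ennreal (k / w) \<le> ?S"
    \<comment> \<open>The value \<open>k / w\<close> is not among the radii, so it is approached
      from below.\<close>
    proof (rule dense_le)
      fix x assume x: "x < ennreal (k / w)"
      then obtain \<rho> where \<rho>: "0 \<le> \<rho>" "x = ennreal \<rho>"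
        by (cases x) auto
      with x have "\<rho> * w < k"
        using w by (simp add: ennreal_less_iff field_simps)
      with \<rho> show "x \<le> ?S"
        by (auto intro!: SUP_upper)
    qed
  qed
  then show ?thesis
    using w k by (simp add: enn2ereal_ennreal)
qed

text \<open>Merging the two nested suprema into one over radii reduces the depth to a single
  question: which radii occur at some point that is cut off?\<close>

lemma cut_depth_eq_SUP:
  fixes P :: "'a::euclidean_space set"
  shows "cut_depth P \<alpha> \<beta> =
    (SUP \<rho> \<in> {\<rho>. 0 \<le> \<rho> \<and> (\<exists>x\<in>P. \<alpha> \<bullet> x < \<beta> \<and> cball x \<rho> \<inter> affine hull P \<subseteq> P)}. ennreal \<rho>)"
  unfolding cut_depth_def set_depth_def point_depth_def
proof (rule antisym)
  show "(SUP x \<in> P - {x \<in> P. \<beta> \<le> \<alpha> \<bullet> x}.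
      SUP r \<in> {r. 0 \<le> r \<and> cball x r \<inter> affine hull P \<subseteq> P}. ennreal r) \<le>
    (SUP \<rho> \<in> {\<rho>. 0 \<le> \<rho> \<and> (\<exists>x\<in>P. \<alpha> \<bullet> x < \<beta> \<and> cball x \<rho> \<inter> affine hull P \<subseteq> P)}. ennreal \<rho>)"
  proof (intro SUP_least SUP_upper)
    fix x r assume "x \<in> P - {x \<in> P. \<beta> \<le> \<alpha> \<bullet> x}" "r \<in> {r. 0 \<le> r \<and> cball x r \<inter> affine hull P \<subseteq> P}"
    then show "r \<in> {\<rho>. 0 \<le> \<rho> \<and> (\<exists>x\<in>P. \<alpha> \<bullet> x < \<beta> \<and> cball x \<rho> \<inter> affine hull P \<subseteq> P)}"
      by (simp add: not_le) blast
  qed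
  show "(SUP \<rho> \<in> {\<rho>. 0 \<le> \<rho> \<and> (\<exists>x\<in>P. \<alpha> \<bullet> x < \<beta> \<and> cball x \<rho> \<inter> affine hull P \<subseteq> P)}. ennreal \<rho>) \<le>
    (SUP x \<in> P - {x \<in> P. \<beta> \<le> \<alpha> \<bullet> x}.
      SUP r \<in> {r. 0 \<le> r \<and> cball x r \<inter> affine hull P \<subseteq> P}. ennreal r)"
  proof (rule SUP_least)
    fix r assume "r \<in> {\<rho>. 0 \<le> \<rho> \<and> (\<exists>x\<in>P. \<alpha> \<bullet> x < \<beta> \<and> cball x \<rho> \<inter> affine hull P \<subseteq> P)}"
    then obtain x where "x \<in> P" "\<not> \<beta> \<le> \<alpha> \<bullet> x" "0 \<le> r" "cball x r \<inter> affine hull P \<subseteq> P"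
      by (auto simp: not_le)
    then show "ennreal r \<le> (SUP x \<in> P - {x \<in> P. \<beta> \<le> \<alpha> \<bullet> x}.
        SUP r \<in> {r. 0 \<le> r \<and> cball x r \<inter> affine hull P \<subseteq> P}. ennreal r)"
      by (intro SUP_upper2[of x] SUP_upper) auto
  qed
qed

theorem mainTheorem8:
  fixes P \<L> :: "(real^'n) set"
    and v q \<alpha> :: "real^'n"
    and \<beta> :: real
    and I :: "'r::finite set"
    and A T L :: "real^'n^'r"
    and b \<xi> :: "real^'r"
  assumes cone: "simple_pointed_cone P v"
    and aff: "\<L> = affine hull P"
    and P_eq: "P = {x \<in> \<L>. \<forall>i\<in>I. A $ i \<bullet> x \<le> b $ i}"
    and irredundant: "\<And>i. i \<in> I \<Longrightarrow> {x \<in> \<L>. \<forall>j\<in>I - {i}. A $ j \<bullet> x \<le> b $ j} \<noteq> P"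
    and L_rows: "int (card (- I)) = int CARD('n) - aff_dim \<L>"
    and L_rank: "dim (($) L ` (- I)) = card (- I)"
    and L_eq: "\<L> = {x. \<forall>j\<in>- I. L $ j \<bullet> x = \<xi> $ j}"
    and T_norm: "\<And>i. i \<in> I \<Longrightarrow> norm (T $ i) = 1"
    and T_dir: "\<And>i. i \<in> I \<Longrightarrow> \<forall>j\<in>- I. L $ j \<bullet> T $ i = 0"
    and T_eq: "\<And>i. i \<in> I \<Longrightarrow> \<exists>h. {x \<in> \<L>. A $ i \<bullet> x \<le> b $ i} = {x \<in> \<L>. T $ i \<bullet> x \<le> h}"
    and q: "q = - (matrix_inv (stack I T L) *v stack I 1 0)"
    and valid: "valid_inequality \<alpha> \<beta> (P \<inter> integer_points)"
    and no_ray: "\<not> (\<exists>r \<in> recession_cone P. r \<noteq> 0 \<and> \<alpha> \<bullet> r < \<beta>)"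
    and vertex: "\<alpha> \<bullet> v \<le> \<beta>"
    and q_gt: "\<alpha> \<bullet> q > \<beta>"
  shows "enn2ereal (cut_depth P \<alpha> \<beta>) = ereal (\<beta> - \<alpha> \<bullet> v) / ereal (\<alpha> \<bullet> q)"
proof -

  \<comment> \<open>Moving the vertex to the origin\<close>
  obtain R where R: "finite R" "independent R" and card_R: "int (card R) = aff_dim P"
    and aff_R: "affine hull P = {v + y |y. y \<in> span R}"
    and P_R: "P = {v + y |y. y \<in> simplicial_cone R}"
    using simple_pointed_cone_rays[OF cone] by blast
  define C where C_eq: "C = simplicial_cone R"
  note C_def = C_eq[unfolded simplicial_cone_def]
  have P_iff: "v + y \<in> P \<longleftrightarrow> y \<in> C" for y
    unfolding P_R C_eq by auto
  have L_iff: "v + y \<in> \<L> \<longleftrightarrow> y \<in> span R" for y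
    unfolding aff aff_R by auto
  have C0: "0 \<in> C"
    unfolding C_def by (auto intro!: exI[of _ "\<lambda>_. 0"])
  have cone_C: "Convex.cone C"
    unfolding Convex.cone_def
  proof (intro ballI allI impI)
    fix y and a :: real assume "y \<in> C" "0 \<le> a"
    then obtain c where c: "y = (\<Sum>r\<in>R. c r *\<^sub>R r)" "\<forall>r\<in>R. 0 \<le> c r"
      unfolding C_def by auto
    then show "a *\<^sub>R y \<in> C"
      unfolding C_def using \<open>0 \<le> a\<close>
      by (intro CollectI exI[of _ "\<lambda>r. a * c r"]) (simp add: scaleR_sum_right)
  qed
  \<comment> \<open>The case \<open>y = 0\<close> says that \<open>v\<close> itself solves the
    system defining \<L>, so the right-hand side \<xi> cancels.\<close>
  have span_iff: "y \<in> span R \<longleftrightarrow> (\<forall>j\<in>- I. L $ j \<bullet> y = 0)" for y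
    using L_iff[of 0] L_iff[of y] by (auto simp: L_eq inner_add_right span_0)
  define h where "h i = (SOME c. {x \<in> \<L>. A $ i \<bullet> x \<le> b $ i} = {x \<in> \<L>. T $ i \<bullet> x \<le> c})" for i
  have h: "{x \<in> \<L>. A $ i \<bullet> x \<le> b $ i} = {x \<in> \<L>. T $ i \<bullet> x \<le> h i}" if "i \<in> I" for i
    unfolding h_def by (rule someI_ex) (rule T_eq[OF that])
  \<comment> \<open>The index set \<open>J\<close> is kept general: \<open>J = I\<close> describes
    \<open>P\<close>, and \<open>J = I - {i}\<close> carries irredundancy over from \<open>A\<close>
    to \<open>T\<close>.\<close>
  have halfspaces: "{x \<in> \<L>. \<forall>j\<in>J. A $ j \<bullet> x \<le> b $ j} = {x \<in> \<L>. \<forall>j\<in>J. T $ j \<bullet> x \<le> h j}"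
    if "J \<subseteq> I" for J
    using h that by blast
  define k where "k i = h i - T $ i \<bullet> v" for i
  have shifted: "v + y \<in> {x \<in> \<L>. \<forall>j\<in>J. A $ j \<bullet> x \<le> b $ j} \<longleftrightarrow>
      y \<in> {y \<in> span R. \<forall>j\<in>J. T $ j \<bullet> y \<le> k j}" if "J \<subseteq> I" for J y
    unfolding halfspaces[OF that] using L_iff[of y]
    by (auto simp: k_def inner_add_right algebra_simps)
  have C_k: "C = {y \<in> span R. \<forall>i\<in>I. T $ i \<bullet> y \<le> k i}"
    using P_iff shifted[of I] P_eq by blast
  have irr_k: "{y \<in> span R. \<forall>j\<in>I - {i}. T $ j \<bullet> y \<le> k j} \<noteq> C" if "i \<in> I" for i
  proof
    assume "{y \<in> span R. \<forall>j\<in>I - {i}. T $ j \<bullet> y \<le> k j} = C"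
    then have "v + y \<in> {x \<in> \<L>. \<forall>j\<in>I - {i}. A $ j \<bullet> x \<le> b $ j} \<longleftrightarrow> v + y \<in> P" for y
      using shifted[of "I - {i}" y] P_iff[of y] by blast
    then have "{x \<in> \<L>. \<forall>j\<in>I - {i}. A $ j \<bullet> x \<le> b $ j} = P"
      by (metis (no_types, lifting) add.commute diff_add_cancel subsetI subset_antisym)
    then show False
      using irredundant[OF that] by simp
  qed
  have k0: "k i = 0" if "i \<in> I" for i
    using irredundant_cone_constraints_tight[OF _ cone_C C0 subspace_span C_k irr_k that] by simp
  have C_T: "C = {y \<in> span R. \<forall>i\<in>I. T $ i \<bullet> y \<le> 0}"
    unfolding C_k using k0 by auto
  have irr_T: "{y \<in> span R. \<forall>j\<in>I - {i}. T $ j \<bullet> y \<le> 0} \<noteq> C" if "i \<in> I" for i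
    using irr_k[OF that] k0 by auto
  note facets = simplicial_cone_facets[OF R finite C_T[unfolded C_eq] irr_T[unfolded C_eq]]

  \<comment> \<open>The stacked matrix is square and injective, which determines
    \<open>q\<close>\<close>
  have "aff_dim \<L> = int (card I)"
    using facets(1) card_R by (simp add: aff aff_dim_affine_hull)
  then have "card I + card (- I) = CARD('n)"
    using L_rows by simp
  then have "CARD('r) = CARD('n)"
    by (metis Compl_partition card_Un_disjoint finite inf_compl_bot)
  moreover have stack_row: "(stack I T L *v y) $ i = (if i \<in> I then T $ i else L $ i) \<bullet> y" for y i
    by (simp add: stack_def matrix_vector_mul_component)
  \<comment> \<open>The lower rows put a kernel vector into \<open>span R\<close>; there, the
    vanishing of the upper rows forces it to be zero.\<close>
  moreover have "y = 0" if "stack I T L *v y = 0" for y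
  proof (rule facets(2))
    show "y \<in> span R"
      unfolding span_iff using stack_row[of y] that by (metis ComplD zero_index)
    show "T $ i \<bullet> y = 0" if "i \<in> I" for i
      using stack_row[of y i] that \<open>stack I T L *v y = 0\<close> by simp
  qed
  ultimately have "stack I T L *v q = - stack I 1 0"
    unfolding q using matrix_vector_mul_matrix_inv[of "stack I T L" "stack I 1 0"]
    by (simp add: vec.neg)
  then have stack_q: "(if i \<in> I then T $ i else L $ i) \<bullet> q = (if i \<in> I then - 1 else 0)" for i
    using stack_row[of q i] by (cases "i \<in> I") (auto simp: stack_def)
  have Tq: "T $ i \<bullet> q = - 1" if "i \<in> I" for i
    using stack_q[of i] that by simp
  have q_span: "q \<in> span R"
    unfolding span_iff using stack_q by (metis ComplD)
  have qC: "q \<in> C"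
    unfolding C_T using q_span Tq by simp

  \<comment> \<open>Nonnegativity of \<alpha> on the cone\<close>
  have "C \<subseteq> recession_cone P"
  proof
    fix r assume r: "r \<in> C"
    show "r \<in> recession_cone P"
      unfolding recession_cone_def
    proof (intro CollectI ballI allI impI)
      fix x and c :: real assume "x \<in> P" "0 \<le> c"
      then obtain y where y: "x = v + y" "y \<in> C"
        using P_R C_eq by blast
      have "y + c *\<^sub>R r \<in> C"
        using r y(2) \<open>0 \<le> c\<close> unfolding C_T
        by (auto simp: span_add span_scale inner_add_right mult_nonneg_nonpos add_nonpos_nonpos)
      then show "x + c *\<^sub>R r \<in> P"
        using P_iff[of "y + c *\<^sub>R r"] y(1) by (simp add: add.assoc)
    qed
  qed
  then have ray_ge: "\<beta> \<le> \<alpha> \<bullet> r" if "r \<in> C" "r \<noteq> 0" for r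
    using no_ray that by force
  have \<alpha>_nonneg: "0 \<le> \<alpha> \<bullet> r" if r: "r \<in> C" for r
  proof (rule ccontr)
    assume "\<not> 0 \<le> \<alpha> \<bullet> r"
    then have neg: "\<alpha> \<bullet> r < 0" "r \<noteq> 0" by auto
    \<comment> \<open>The factor scales the value of \<alpha> on the ray to
      \<open>- (\<bar>\<beta>\<bar> + 1)\<close>, which is below \<beta> whatever the sign of
      \<beta>.\<close>
    define c where "c = (\<bar>\<beta>\<bar> + 1) / - (\<alpha> \<bullet> r)"
    have c: "c > 0" "c * (\<alpha> \<bullet> r) = - (\<bar>\<beta>\<bar> + 1)"
      using neg by (auto simp: c_def divide_pos_neg)
    then have "c *\<^sub>R r \<in> C" "c *\<^sub>R r \<noteq> 0"
      using cone_C r neg unfolding Convex.cone_def by auto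
    then have "\<beta> \<le> c * (\<alpha> \<bullet> r)"
      using ray_ge by fastforce
    then show False
      using c(2) by linarith
  qed

  \<comment> \<open>Radii attained at points that are cut off\<close>
  have "(\<exists>x\<in>P. \<alpha> \<bullet> x < \<beta> \<and> cball x \<rho> \<inter> affine hull P \<subseteq> P) \<longleftrightarrow> \<rho> * (\<alpha> \<bullet> q) < \<beta> - \<alpha> \<bullet> v"
    if \<rho>: "0 \<le> \<rho>" for \<rho>
  proof
    assume "\<exists>x\<in>P. \<alpha> \<bullet> x < \<beta> \<and> cball x \<rho> \<inter> affine hull P \<subseteq> P"
    then obtain y where y: "y \<in> C" "\<alpha> \<bullet> (v + y) < \<beta>" "cball (v + y) \<rho> \<inter> \<L> \<subseteq> P"
      using P_R aff unfolding C_eq by blast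
    \<comment> \<open>Moving from \<open>v + y\<close> by \<open>\<rho>\<close> towards each facet bounds the slacks of \<open>y\<close> below by \<open>\<rho>\<close>.\<close>
    have "y - \<rho> *\<^sub>R q \<in> C"
    proof -
      have "T $ i \<bullet> y + \<rho> \<le> 0" if i: "i \<in> I" for i
      proof -
        have "y + \<rho> *\<^sub>R T $ i \<in> span R"
          using y(1) T_dir[OF i] unfolding C_T by (intro span_add span_scale) (auto simp: span_iff)
        moreover have "v + (y + \<rho> *\<^sub>R T $ i) \<in> cball (v + y) \<rho>"
          using T_norm[OF i] \<rho> by (simp add: dist_norm)
        ultimately have "y + \<rho> *\<^sub>R T $ i \<in> C"
          using y(3) P_iff L_iff by blast
        then have "T $ i \<bullet> (y + \<rho> *\<^sub>R T $ i) \<le> 0"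
          using i unfolding C_T by blast
        then show ?thesis
          using T_norm[OF i] by (simp add: inner_add_right dot_square_norm)
      qed
      then show ?thesis
        using y(1) q_span Tq unfolding C_T by (auto simp: span_diff span_scale inner_diff_right)
    qed
    \<comment> \<open>Here \<open>y\<close> is \<open>\<rho> *\<^sub>R q\<close> plus an element of
      \<open>C\<close>, and \<alpha> cannot decrease when that element is added.\<close>
    then have "\<rho> * (\<alpha> \<bullet> q) \<le> \<alpha> \<bullet> y"
      using \<alpha>_nonneg by (fastforce simp: inner_diff_right)
    then show "\<rho> * (\<alpha> \<bullet> q) < \<beta> - \<alpha> \<bullet> v"
      using y(2) by (simp add: inner_add_right)
  next
    assume less: "\<rho> * (\<alpha> \<bullet> q) < \<beta> - \<alpha> \<bullet> v"
    have "cball (v + \<rho> *\<^sub>R q) \<rho> \<inter> \<L> \<subseteq> P"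
    proof
      fix x assume x: "x \<in> cball (v + \<rho> *\<^sub>R q) \<rho> \<inter> \<L>"
      define u where "u = x - (v + \<rho> *\<^sub>R q)"
      have u: "x = v + (\<rho> *\<^sub>R q + u)" "norm u \<le> \<rho>"
        using x by (auto simp: u_def dist_norm norm_minus_commute)
      \<comment> \<open>The rows of \<open>T\<close> are unit vectors, so
        \<open>T $ i \<bullet> u \<le> \<rho>\<close>, and the slack \<rho> provided by
        \<open>\<rho> *\<^sub>R q\<close> absorbs exactly this.\<close>
      have "T $ i \<bullet> (\<rho> *\<^sub>R q + u) \<le> 0" if "i \<in> I" for i
        using norm_cauchy_schwarz[of "T $ i" u] T_norm[OF that] Tq[OF that] u(2)
        by (simp add: inner_add_right)
      moreover have "\<rho> *\<^sub>R q + u \<in> span R"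
        using x u(1) L_iff by simp
      ultimately show "x \<in> P"
        unfolding u(1) P_iff C_T by simp
    qed
    moreover have "v + \<rho> *\<^sub>R q \<in> P"
      using cone_C qC \<rho> unfolding P_iff Convex.cone_def by blast
    ultimately show "\<exists>x\<in>P. \<alpha> \<bullet> x < \<beta> \<and> cball x \<rho> \<inter> affine hull P \<subseteq> P"
      using less unfolding aff by (intro bexI[of _ "v + \<rho> *\<^sub>R q"]) (auto simp: inner_add_right)
  qed
  then have "cut_depth P \<alpha> \<beta> =
      (SUP \<rho> \<in> {\<rho>. 0 \<le> \<rho> \<and> \<rho> * (\<alpha> \<bullet> q) < \<beta> - \<alpha> \<bullet> v}. ennreal \<rho>)"
    unfolding cut_depth_eq_SUP by (simp cong: conj_cong)
  then show ?thesis
    using enn2ereal_SUP_mult_less[of "\<beta> - \<alpha> \<bullet> v" "\<alpha> \<bullet> q"] vertex \<alpha>_nonneg[OF qC] by simp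
qed

end
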